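(* Let $K\subset\mathbb{R}$ be a compact set with infinitely many points and let $w\colon K\to(0,\infty)$ be continuous. The set of polynomial compositions of a fixed layer-degree pattern need not be closed in $C(K)$: for every integer $d_1\ge 2$, with $p_k(x)=x^{d_1}+kx$ and $q_k(y)=y/k$ for $k=1,2,3,\dots$, the compositions $q_k\circ p_k$ converge uniformly on $K$, as $k\to\infty$, to the identity function $x\mapsto x$, which is not (as a function on $K$) a composition $q\circ p$ of polynomials with $\deg p=d_1$ and $\deg q=1$. Consequently the infimum $$\inf_{Q\in\mathcal{Q}'}\|f-Q\|_{\infty,K}$$ over a family $\mathcal{Q}'$ of weighted deep polynomials with fixed layer-degree patterns and fixed exponent $\alpha\ge0$ need not be attained inside $\mathcal{Q}'$ itself; i.e. there exist such a family $\mathcal{Q}'$ and $f\in C(K)$ for which no element of $\mathcal{Q}'$ attains the infimum.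
   Context: $C(K)$ is the space of real-valued continuous functions on $K$ with the uniform norm $\|g\|_{\infty,K}:=\max_{x\in K}|g(x)|$. Polynomials are univariate algebraic polynomials with real coefficients. A layer-degree pattern is a finite tuple of integers $\ge 1$ prescribing the exact degrees of the polynomial layers of a composition; the pattern $(d_1,1)$ refers to compositions $q\circ p$ with inner layer $p$ of degree $d_1$ and outer layer $q$ of degree $1$. A family of weighted deep polynomials with fixed layer-degree patterns and fixed exponent $\alpha\ge 0$ is the set of all functions on $K$ of the form $[w]^\alpha P$, where $P$ is a composition of polynomials whose layer degrees follow one of the patterns in a given finite nonempty list and $[w]^\alpha$ denotes the pointwise power $x\mapsto w(x)^\alpha$. *)

theory Defs
  imports "HOL-Analysis.Analysis" "HOL-Computational_Algebra.Polynomial"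
begin

text \<open>
  Functions on \<open>K\<close> are represented extensionally (\<open>undefined\<close> outside \<open>K\<close>), so that
  equality in HOL is equality on \<open>K\<close>.
\<close>

definition C_space :: "real set \<Rightarrow> (real \<Rightarrow> real) metric" where
  "C_space K = cfunspace (top_of_set K) euclidean_metric"

definition sup_norm :: "real set \<Rightarrow> (real \<Rightarrow> real) \<Rightarrow> real" where
  "sup_norm K g = (SUP x\<in>K. \<bar>g x\<bar>)"

lemma mem_C_space_iff:
  assumes "compact K"
  shows "f \<in> mspace (C_space K) \<longleftrightarrow> continuous_on K f \<and> f \<in> extensional K"
proof -
  have "bounded (f ` K)" if "continuous_on K f"
    using compact_continuous_image[OF that assms] compact_imp_bounded by blast
  then show ?thesis
    unfolding C_space_def by auto
qed

text \<open>For continuous functions on a nonempty compact set the supremum is a maximum.\<close>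

lemma sup_norm_attained:
  assumes "compact K" "K \<noteq> {}" "continuous_on K g"
  shows "\<exists>x\<in>K. sup_norm K g = \<bar>g x\<bar> \<and> (\<forall>y\<in>K. \<bar>g y\<bar> \<le> \<bar>g x\<bar>)"
proof -
  have "continuous_on K (\<lambda>x. \<bar>g x\<bar>)"
    using assms(3) by (intro continuous_intros)
  then obtain x where x: "x \<in> K" "\<forall>y\<in>K. \<bar>g y\<bar> \<le> \<bar>g x\<bar>"
    using continuous_attains_sup[OF assms(1,2)] by blast
  then have "sup_norm K g = \<bar>g x\<bar>"
    unfolding sup_norm_def by (intro cSup_eq_maximum) auto
  with x show ?thesis by blast
qed

lemma mdist_C_space:
  assumes "compact K" "K \<noteq> {}" "f \<in> mspace (C_space K)" "g \<in> mspace (C_space K)"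
  shows "mdist (C_space K) f g = sup_norm K (\<lambda>x. f x - g x)"
proof -
  have "f \<in> mspace (funspace K euclidean_metric)" "g \<in> mspace (funspace K euclidean_metric)"
    using assms(3,4) cfunspace_subset_funspace[of "top_of_set K" "euclidean_metric :: real metric"]
    unfolding C_space_def by auto
  then show ?thesis
    using assms(2)
    by (simp add: C_space_def mdist_cfunspace_eq_mdist_funspace Met_TC.fdist_def
        sup_norm_def dist_real_def)
qed

definition degree_pattern :: "nat list \<Rightarrow> bool" where
  "degree_pattern ds \<longleftrightarrow> ds \<noteq> [] \<and> (\<forall>d\<in>set ds. 1 \<le> d)"

text \<open>
  Layers are listed from the innermost to the outermost one:
  \<open>compose_layers [p\<^sub>1, \<dots>, p\<^sub>m]\<close> is the polynomial \<open>p\<^sub>m \<circ> \<dots> \<circ> p\<^sub>1\<close>.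
\<close>

definition compose_layers :: "real poly list \<Rightarrow> real poly" where
  "compose_layers ps = fold pcompose ps [:0, 1:]"

lemma compose_layers_two:
  "poly (compose_layers [p, q]) x = poly q (poly p x)"
  by (simp add: compose_layers_def poly_pcompose)

definition deep_polys :: "nat list \<Rightarrow> real poly set" where
  "deep_polys ds = {compose_layers ps | ps. map degree ps = ds}"

definition deep_functions :: "real set \<Rightarrow> nat list \<Rightarrow> (real \<Rightarrow> real) set" where
  "deep_functions K ds = {restrict (poly P) K | P. P \<in> deep_polys ds}"

definition weighted_deep_family ::
  "real set \<Rightarrow> (real \<Rightarrow> real) \<Rightarrow> real \<Rightarrow> nat list list \<Rightarrow> (real \<Rightarrow> real) set" where
  "weighted_deep_family K w \<alpha> dss =
     {restrict (\<lambda>x. w x powr \<alpha> * poly P x) K | P. \<exists>ds\<in>set dss. P \<in> deep_polys ds}"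

text \<open>
  \<open>closedin\<close> includes the subset condition, so the following inclusion shows that non-closedness
  of a set of deep polynomials in \<open>C(K)\<close> is a matter of limits only.
\<close>

lemma deep_functions_subset_C_space:
  assumes "compact K"
  shows "deep_functions K ds \<subseteq> mspace (C_space K)"
  using assms
  by (auto simp del: mspace_cfunspace simp: deep_functions_def mem_C_space_iff
      intro!: continuous_intros)

lemma weighted_deep_family_subset_C_space:
  assumes "compact K" "continuous_on K w" "\<forall>x\<in>K. 0 < w x"
  shows "weighted_deep_family K w \<alpha> dss \<subseteq> mspace (C_space K)"
proof -
  have "continuous_on K (\<lambda>x. w x powr \<alpha> * poly P x)" for P
    using assms by (intro continuous_intros) auto
  then show ?thesis
    using assms(1) by (auto simp: weighted_deep_family_def mem_C_space_iff)
qed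

end

(* Being a degree-d composition is a condition on exact degrees. On an infinite set a polynomial
   function determines its polynomial, so the identity is not such a composition when d >= 2; but
   x + x^d / k is one, and the leading coefficient 1 / k disappears in the limit. The distance from
   the identity to the family is therefore 0 and is not attained; the exponent 0 removes the weight
   from the family, so this already gives the second claim. *)

theory Submission
  imports Defs
begin

lemma compose_layers_pair: "compose_layers [p, q] = pcompose q p"
  by (simp add: compose_layers_def pcompose_idR)

text \<open>Composition multiplies degrees over a field. This is the only property of the pattern
  \<open>[m, n]\<close> needed to exclude the identity.\<close>

lemma degree_deep_polys_pair:
  assumes "P \<in> deep_polys [m, n]"
  shows "degree P = n * m"
proof -
  obtain ps where ps: "P = compose_layers ps" "map degree ps = [m, n]"
    using assms by (auto simp: deep_polys_def)
  then obtain p q where "ps = [p, q]" "degree p = m" "degree q = n"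
    by (auto simp: map_eq_Cons_conv)
  with ps show ?thesis
    by (simp add: compose_layers_pair degree_pcompose)
qed

lemma restrict_comp_in_deep_functions:
  assumes "degree p = m" "degree q = n"
  shows "restrict (\<lambda>x. poly q (poly p x)) K \<in> deep_functions K [m, n]"
proof -
  have "compose_layers [p, q] \<in> deep_polys [m, n]"
    unfolding deep_polys_def using assms by (intro CollectI exI[of _ "[p, q]"]) auto
  moreover have "restrict (\<lambda>x. poly q (poly p x)) K = restrict (poly (compose_layers [p, q])) K"
    by (intro restrict_ext) (simp add: compose_layers_two)
  ultimately show ?thesis
    unfolding deep_functions_def by blast
qed

text \<open>Otherwise \<open>p - q\<close> would be a nonzero polynomial with infinitely many
  roots.\<close>

lemma poly_eq_if_eq_on_infinite:
  fixes p q :: "'a::{comm_ring_1,ring_no_zero_divisors} poly"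
  assumes "infinite S" "\<And>x. x \<in> S \<Longrightarrow> poly p x = poly q x"
  shows "p = q"
proof (rule ccontr)
  assume "p \<noteq> q"
  then have "finite {x. poly (p - q) x = 0}"
    by (intro poly_roots_finite) simp
  moreover have "S \<subseteq> {x. poly (p - q) x = 0}"
    using assms(2) by auto
  ultimately show False
    using assms(1) finite_subset by blast
qed

text \<open>Agreement on the infinite set \<open>K\<close> would force the composed polynomial to be
  \<open>[:0, 1:]\<close>, whose degree 1 would then have to equal \<open>n * m\<close>.\<close>

lemma id_notin_deep_functions:
  assumes "infinite K" "n * m \<noteq> 1"
  shows "restrict (\<lambda>x. x) K \<notin> deep_functions K [m, n]"
proof
  assume "restrict (\<lambda>x. x) K \<in> deep_functions K [m, n]"
  then obtain P where P: "P \<in> deep_polys [m, n]" "restrict (\<lambda>x. x) K = restrict (poly P) K"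
    by (auto simp: deep_functions_def)
  have "poly P x = poly [:0, 1:] x" if "x \<in> K" for x
    using fun_cong[OF P(2), of x] that by simp
  then have "P = [:0, 1:]"
    by (rule poly_eq_if_eq_on_infinite[OF assms(1)])
  then show False
    using degree_deep_polys_pair[OF P(1)] assms(2) by simp
qed

text \<open>From degree 2 on, the linear summand cannot touch the leading coefficient. For
  \<open>d = 1\<close> the two coefficients would merge into \<open>1 + c\<close>, which may
  vanish.\<close>

lemma degree_monom_add_linear:
  fixes c :: "'a::comm_semiring_1"
  assumes "2 \<le> d"
  shows "degree (monom 1 d + [:0, c:]) = d"
proof -
  have "degree (monom 1 d + [:0, c:]) = degree (monom (1::'a) d)"
    using assms by (intro degree_add_eq_left) (auto simp: degree_monom_eq)
  then show ?thesis
    by (simp add: degree_monom_eq)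
qed

text \<open>The deviation from the identity is exactly \<open>x ^ d / k\<close>, and a bound
  \<open>b\<close> for \<open>\<bar>x\<bar>\<close> on \<open>K\<close> turns this into the uniform
  estimate \<open>b ^ d / k\<close>.\<close>

lemma uniform_limit_rescaled_perturbation:
  fixes K :: "real set"
  assumes "bounded K"
  shows "uniform_limit K
    (\<lambda>k x. poly [:0, 1 / real k:] (poly (monom 1 d + [:0, real k:]) x)) (\<lambda>x. x) sequentially"
proof (rule uniform_limitI)
  fix e :: real
  assume "0 < e"
  obtain b where b: "\<And>x. x \<in> K \<Longrightarrow> \<bar>x\<bar> \<le> b"
    using assms by (auto simp: bounded_iff)
  have "(\<lambda>k. b ^ d / real k) \<longlonglongrightarrow> 0"
    by (rule lim_const_over_n)
  then have "eventually (\<lambda>k. b ^ d / real k < e) sequentially"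
    using \<open>0 < e\<close> by (rule order_tendstoD(2))
  then show "\<forall>\<^sub>F k in sequentially. \<forall>x\<in>K.
    dist (poly [:0, 1 / real k:] (poly (monom 1 d + [:0, real k:]) x)) x < e"
    \<comment> \<open>The index 0 is excluded because \<open>1 / 0 = 0\<close> in HOL: the
      composition would be the zero function there, and the formula for the deviation would
      fail.\<close>
    using eventually_gt_at_top[of 0]
  proof eventually_elim
    case (elim k)
    show ?case
    proof
      fix x
      assume "x \<in> K"
      have "poly [:0, 1 / real k:] (poly (monom 1 d + [:0, real k:]) x) - x = x ^ d / real k"
        using elim(2) by (simp add: poly_monom field_simps)
      then have "dist (poly [:0, 1 / real k:] (poly (monom 1 d + [:0, real k:]) x)) x
          = \<bar>x\<bar> ^ d / real k"
        by (simp add: dist_real_def power_abs)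
      also have "\<dots> \<le> b ^ d / real k"
        using b[OF \<open>x \<in> K\<close>] by (intro divide_right_mono power_mono) auto
      also have "\<dots> < e"
        by (rule elim(1))
      finally show "dist (poly [:0, 1 / real k:] (poly (monom 1 d + [:0, real k:]) x)) x < e" .
    qed
  qed
qed

lemma deep_functions_approximate_id:
  assumes "bounded K" "K \<noteq> {}" "2 \<le> d" "0 < e"
  shows "\<exists>Q\<in>deep_functions K [d, 1]. sup_norm K (\<lambda>x. restrict (\<lambda>x. x) K x - Q x) < e"
proof -
  define F where
    "F k x = poly [:0, 1 / real k:] (poly (monom 1 d + [:0, real k:]) x)" for k :: nat and x
  \<comment> \<open>Strict pointwise bounds give only a non-strict bound on the supremum, hence
    \<open>e / 2\<close> in place of \<open>e\<close>.\<close>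
  have "\<forall>\<^sub>F k in sequentially. \<forall>x\<in>K. dist (F k x) x < e / 2"
    unfolding F_def
    by (rule uniform_limitD[OF uniform_limit_rescaled_perturbation[OF assms(1)] half_gt_zero[OF assms(4)]])
  then have "\<forall>\<^sub>F k in sequentially. 0 < k \<and> (\<forall>x\<in>K. dist (F k x) x < e / 2)"
    by (intro eventually_conj eventually_gt_at_top)
  then obtain k :: nat where k: "0 < k" "\<forall>x\<in>K. dist (F k x) x < e / 2"
    using eventually_happens'[OF sequentially_bot] by blast
  have "sup_norm K (\<lambda>x. restrict (\<lambda>x. x) K x - restrict (F k) K x) \<le> e / 2"
    unfolding sup_norm_def using k(2) assms(2)
    by (intro cSUP_least) (auto simp: dist_real_def abs_minus_commute intro: less_imp_le)
  moreover have "restrict (F k) K \<in> deep_functions K [d, 1]"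
    unfolding F_def using k(1)
    by (intro restrict_comp_in_deep_functions degree_monom_add_linear assms(3)) simp
  ultimately show ?thesis
    using assms(4) by (intro bexI[of _ "restrict (F k) K"]) simp_all
qed

text \<open>A closed set misses a whole ball around each point outside it, whereas \<open>f\<close>
  has elements of \<open>S\<close> at every positive distance.\<close>

lemma not_closedin_mtopology_ofI:
  assumes "f \<in> mspace m" "f \<notin> S" "\<And>e. 0 < e \<Longrightarrow> \<exists>g\<in>S. mdist m f g < e"
  shows "\<not> closedin (mtopology_of m) S"
proof
  assume closed: "closedin (mtopology_of m) S"
  interpret Metric_space "mspace m" "mdist m"
    by simp
  have "S \<subseteq> mspace m" "\<exists>r>0. disjnt S (mball f r)"
    using closed assms(1,2) unfolding mtopology_of_def closedin_metric by auto
  then show False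
    using assms(1,3) by (fastforce simp: disjnt_iff in_mball)
qed

text \<open>Approximability pushes the infimum down to 0, so a minimizer would be at distance 0 from
  \<open>f\<close> and hence equal to \<open>f\<close>, which lies outside \<open>S\<close>.\<close>

lemma inf_sup_norm_not_attained:
  assumes "compact K" "K \<noteq> {}" "S \<subseteq> mspace (C_space K)" "f \<in> mspace (C_space K)" "f \<notin> S"
    and approx: "\<And>e. 0 < e \<Longrightarrow> \<exists>Q\<in>S. sup_norm K (\<lambda>x. f x - Q x) < e"
  shows "\<not> (\<exists>Q\<in>S. sup_norm K (\<lambda>x. f x - Q x) = (INF Q'\<in>S. sup_norm K (\<lambda>x. f x - Q' x)))"
proof
  assume "\<exists>Q\<in>S. sup_norm K (\<lambda>x. f x - Q x) = (INF Q'\<in>S. sup_norm K (\<lambda>x. f x - Q' x))"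
  then obtain Q where Q: "Q \<in> S"
    "sup_norm K (\<lambda>x. f x - Q x) = (INF Q'\<in>S. sup_norm K (\<lambda>x. f x - Q' x))"
    by blast
  \<comment> \<open>Reading the norm as a metric supplies nonnegativity, hence the lower bound that
    a real \<open>INF\<close> requires, and the fact that distance 0 means equality.\<close>
  have dist_eq: "sup_norm K (\<lambda>x. f x - g x) = mdist (C_space K) f g" if "g \<in> S" for g
    using mdist_C_space[OF assms(1,2,4)] assms(3) that by auto
  then have bdd: "bdd_below ((\<lambda>g. sup_norm K (\<lambda>x. f x - g x)) ` S)"
    by (intro bdd_belowI2[of _ 0]) simp
  have "mdist (C_space K) f Q \<le> 0"
  proof (rule field_le_epsilon)
    fix e :: real
    assume "0 < e"
    then obtain g where g: "g \<in> S" "sup_norm K (\<lambda>x. f x - g x) < e"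
      using approx by blast
    have "mdist (C_space K) f Q \<le> sup_norm K (\<lambda>x. f x - g x)"
      using Q dist_eq cINF_lower[OF bdd g(1)] by simp
    with g(2) show "mdist (C_space K) f Q \<le> 0 + e"
      by simp
  qed
  then have "mdist (C_space K) f Q = 0"
    by (simp add: order_antisym)
  then have "f = Q"
    using mdist_zero[OF assms(4) subsetD[OF assms(3) Q(1)]] by simp
  then show False
    using Q(1) assms(5) by simp
qed

text \<open>Positivity of \<open>w\<close> makes the weight factor 1 on \<open>K\<close>; at a zero
  of \<open>w\<close> it would be \<open>0 powr 0 = 0\<close>.\<close>

lemma weighted_deep_family_exponent_0:
  assumes "\<forall>x\<in>K. 0 < w x"
  shows "weighted_deep_family K w 0 dss = (\<Union>ds\<in>set dss. deep_functions K ds)"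
proof -
  have "restrict (\<lambda>x. w x powr 0 * poly P x) K = restrict (poly P) K" for P
    using assms by (intro restrict_ext) auto
  then show ?thesis
    unfolding weighted_deep_family_def deep_functions_def by auto
qed

theorem mainTheorem4:
  fixes K :: "real set" and w :: "real \<Rightarrow> real"
  assumes "compact K" and "infinite K"
    and "continuous_on K w" and "\<forall>x\<in>K. 0 < w x"
  shows
    "(\<forall>d1::nat. 2 \<le> d1 \<longrightarrow>
       (let p = (\<lambda>k::nat. monom 1 d1 + [:0, real k:]);
            q = (\<lambda>k::nat. [:0, 1 / real k:])
        in (\<forall>k\<ge>1. degree (p k) = d1 \<and> degree (q k) = 1
                \<and> restrict (\<lambda>x. poly (q k) (poly (p k) x)) K \<in> deep_functions K [d1, 1])
         \<and> uniform_limit K (\<lambda>k x. poly (q k) (poly (p k) x)) (\<lambda>x. x) sequentially)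
       \<and> restrict (\<lambda>x. x) K \<notin> deep_functions K [d1, 1]
       \<and> \<not> closedin (mtopology_of (C_space K)) (deep_functions K [d1, 1]))
     \<and> (\<exists>(dss :: nat list list) (\<alpha> :: real) f.
          dss \<noteq> [] \<and> (\<forall>ds\<in>set dss. degree_pattern ds) \<and> 0 \<le> \<alpha>
          \<and> f \<in> mspace (C_space K)
          \<and> \<not> (\<exists>Q\<in>weighted_deep_family K w \<alpha> dss.
                 sup_norm K (\<lambda>x. f x - Q x)
                   = (INF Q'\<in>weighted_deep_family K w \<alpha> dss. sup_norm K (\<lambda>x. f x - Q' x))))"
proof (intro conjI allI impI)
  have K: "bounded K" "K \<noteq> {}"
    using assms(1,2) compact_imp_bounded by auto
  let ?id = "restrict (\<lambda>x. x) K"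
  have id: "?id \<in> mspace (C_space K)"
    using assms(1) by (simp add: mem_C_space_iff)
  {
    fix d :: nat
    assume d: "2 \<le> d"
    show "let p = (\<lambda>k::nat. monom 1 d + [:0, real k:]);
              q = (\<lambda>k::nat. [:0, 1 / real k:])
          in (\<forall>k\<ge>1. degree (p k) = d \<and> degree (q k) = 1
                \<and> restrict (\<lambda>x. poly (q k) (poly (p k) x)) K \<in> deep_functions K [d, 1])
           \<and> uniform_limit K (\<lambda>k x. poly (q k) (poly (p k) x)) (\<lambda>x. x) sequentially"
      unfolding Let_def
    proof (intro conjI allI impI)
      show "degree (monom 1 d + [:0, real k:]) = d" for k
        by (rule degree_monom_add_linear[OF d])
      show deg_q: "degree [:0, 1 / real k:] = 1" if "1 \<le> k" for k
        using that by simp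
      show "restrict (\<lambda>x. poly [:0, 1 / real k:] (poly (monom 1 d + [:0, real k:]) x)) K
          \<in> deep_functions K [d, 1]" if "1 \<le> k" for k
        by (intro restrict_comp_in_deep_functions degree_monom_add_linear d deg_q that)
    qed (rule uniform_limit_rescaled_perturbation[OF K(1)])
    show notin: "?id \<notin> deep_functions K [d, 1]"
      using d by (intro id_notin_deep_functions[OF assms(2)]) simp
    show "\<not> closedin (mtopology_of (C_space K)) (deep_functions K [d, 1])"
    proof (rule not_closedin_mtopology_ofI[OF id notin])
      fix e :: real
      assume "0 < e"
      then obtain Q where "Q \<in> deep_functions K [d, 1]" and "sup_norm K (\<lambda>x. ?id x - Q x) < e"
        using deep_functions_approximate_id[OF K d] by blast
      \<comment> \<open>The approximation is stated in the sup norm, while closedness refers to the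
        metric of \<open>C_space K\<close>.\<close>
      moreover from this have "mdist (C_space K) ?id Q = sup_norm K (\<lambda>x. ?id x - Q x)"
        using mdist_C_space[OF assms(1) K(2) id] deep_functions_subset_C_space[OF assms(1)] by blast
      ultimately show "\<exists>Q\<in>deep_functions K [d, 1]. mdist (C_space K) ?id Q < e"
        by (intro bexI[of _ Q]) simp_all
    qed
  }
  \<comment> \<open>The witness is the single pattern \<open>[2, 1]\<close>, the case
    \<open>d1 = 2\<close> of the first claim, with exponent 0 and the identity as target.\<close>
  have family: "weighted_deep_family K w 0 [[2, 1]] = deep_functions K [2, 1]"
    by (simp add: weighted_deep_family_exponent_0[OF assms(4)])
  show "\<exists>(dss :: nat list list) (\<alpha> :: real) f.
      dss \<noteq> [] \<and> (\<forall>ds\<in>set dss. degree_pattern ds) \<and> 0 \<le> \<alpha>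
      \<and> f \<in> mspace (C_space K)
      \<and> \<not> (\<exists>Q\<in>weighted_deep_family K w \<alpha> dss.
             sup_norm K (\<lambda>x. f x - Q x)
               = (INF Q'\<in>weighted_deep_family K w \<alpha> dss. sup_norm K (\<lambda>x. f x - Q' x)))"
  proof (intro exI conjI)
    show "[[2, 1]] \<noteq> ([] :: nat list list)" "\<forall>ds\<in>set [[2, 1]]. degree_pattern ds" "0 \<le> (0 :: real)"
      by (simp_all add: degree_pattern_def)
    show "?id \<in> mspace (C_space K)"
      by (rule id)
    show "\<not> (\<exists>Q\<in>weighted_deep_family K w 0 [[2, 1]].
        sup_norm K (\<lambda>x. ?id x - Q x)
          = (INF Q'\<in>weighted_deep_family K w 0 [[2, 1]]. sup_norm K (\<lambda>x. ?id x - Q' x)))"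
      unfolding family
      by (intro inf_sup_norm_not_attained assms(1) K id deep_functions_subset_C_space
          id_notin_deep_functions[OF assms(2)] deep_functions_approximate_id) simp_all
  qed
qed

end
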